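(* Let $2/3<\rho<1$, let $\eta_0\in X_\rho$, and let $\eta_t$ and $h_t$ ($t=0,1,2,\dots$) evolve by the high-density (moving frame) dynamics described in the context. Let $h_t^*(k)=h_t(k)+k/3$ and $Q_t=\{q\in\mathbb Z: h_t^*(q)<\inf_{i<q}h_t^*(i)\}$. Then: (a) $Q_t$ is independent of $t$; write $Q=Q_t$. (b) For each $i\in\mathbb Z$, $\eta_t(i)$ and $h_t(i)$ are eventually constant in $t$, and if these limiting values are denoted $\eta_\infty(i)$ and $h_\infty(i)$, then for any two consecutive points $q<q'$ of $Q$ there is an integer $n\ge0$ such that the string $\eta_\infty(q+1)\,\eta_\infty(q+2)\cdots\eta_\infty(q')$ equals $(0\,1\,1)^n\,1$.
   Context: $X=\{0,1\}^{\mathbb Z}$ ($1$ = particle, $0$ = hole); $X_\rho$ is the set of $\eta\in X$ with $\lim_{N\to\infty}\frac1N\sum_{i=1}^N\eta(i)=\lim_{N\to\infty}\frac1N\sum_{i=-N}^{-1}\eta(i)=\rho$. Translation: $(\tau f)(k)=f(k-1)$. F-TASEP step $U:X\to X$: simultaneously, every particle at a site $j$ with $\eta(j-1)=1$ and $\eta(j+1)=0$ moves to $j+1$. High-density dynamics: $\eta_{t+1}=\tau U\eta_t$ (an F-TASEP step followed by a translation by one site to the right). Height profiles: $h_0(0)=0$, $h_0(k)-h_0(k-1)=(-1)^{\eta_0(k)}$. Given $h_t$ and $\eta_t$, let $H_t(k)=h_t(k)+2$ if $\eta_t(k-1)=\eta_t(k)=1$ and $\eta_t(k+1)=0$, and $H_t(k)=h_t(k)$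 otherwise; then $h_{t+1}(k)=H_t(k-1)-1$. With this definition $h_t(k)-h_t(k-1)=(-1)^{\eta_t(k)}$ for all $t,k$. Since $\rho>2/3$, $h^*_t(i)\to\mp\infty$ as $i\to\pm\infty$ and $Q_t$ is unbounded above and below. *)

theory Defs
  imports "HOL-Library.Extended_Real"
begin

text \<open>Configurations in \<open>{0,1}\<close> to the power of the integers; \<open>True\<close> is a particle (1),
  \<open>False\<close> a hole (0).\<close>

type_synonym config = "int \<Rightarrow> bool"

definition X_density :: "real \<Rightarrow> config set" where
  "X_density \<rho> = {\<eta>.
     (\<lambda>N. (\<Sum>i\<in>{1..int N}. of_bool (\<eta> i)) / real N) \<longlonglongrightarrow> \<rho> \<and>
     (\<lambda>N. (\<Sum>i\<in>{- int N..-1}. of_bool (\<eta> i)) / real N) \<longlonglongrightarrow> \<rho>}"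

definition translate :: "(int \<Rightarrow> 'a) \<Rightarrow> int \<Rightarrow> 'a" where
  "translate f k = f (k - 1)"

definition jumps :: "config \<Rightarrow> int \<Rightarrow> bool" where
  "jumps \<eta> j \<longleftrightarrow> \<eta> (j - 1) \<and> \<eta> j \<and> \<not> \<eta> (j + 1)"

definition ftasep_step :: "config \<Rightarrow> config" where
  "ftasep_step \<eta> k \<longleftrightarrow> (\<eta> k \<and> \<not> jumps \<eta> k) \<or> jumps \<eta> (k - 1)"

definition is_height_profile :: "config \<Rightarrow> (int \<Rightarrow> int) \<Rightarrow> bool" where
  "is_height_profile \<eta> h \<longleftrightarrow>
     h 0 = 0 \<and> (\<forall>k. h k - h (k - 1) = (-1) ^ of_bool (\<eta> k))"

definition lifted_height :: "config \<Rightarrow> (int \<Rightarrow> int) \<Rightarrow> int \<Rightarrow> int" where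
  "lifted_height \<eta> h k = (if jumps \<eta> k then h k + 2 else h k)"

definition high_density_evolution ::
    "(nat \<Rightarrow> config) \<Rightarrow> (nat \<Rightarrow> int \<Rightarrow> int) \<Rightarrow> bool" where
  "high_density_evolution \<eta> h \<longleftrightarrow>
     is_height_profile (\<eta> 0) (h 0) \<and>
     (\<forall>t. \<eta> (Suc t) = translate (ftasep_step (\<eta> t))) \<and>
     (\<forall>t k. h (Suc t) k = lifted_height (\<eta> t) (h t) (k - 1) - 1)"

definition hstar :: "(int \<Rightarrow> int) \<Rightarrow> int \<Rightarrow> real" where
  "hstar h k = of_int (h k) + of_int k / 3"

text \<open>The infimum is taken in the extended reals, so that it is \<open>-\<infinity>\<close> (and not an
  unspecified real) when the profile is unbounded below on the left.\<close>

definition Q_set :: "(int \<Rightarrow> int) \<Rightarrow> int set" where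
  "Q_set h = {q. ereal (hstar h q) < (INF i\<in>{..<q}. ereal (hstar h i))}"

definition consecutive_in :: "int set \<Rightarrow> int \<Rightarrow> int \<Rightarrow> bool" where
  "consecutive_in Q q q' \<longleftrightarrow> q \<in> Q \<and> q' \<in> Q \<and> q < q' \<and> (\<forall>r\<in>Q. \<not> (q < r \<and> r < q'))"

end

theory Submission
  imports Defs
begin

text \<open>Consider the integer-valued tilted height \<open>g k = 3 h k + k\<close>. It drops by 2 at a particle
  and rises by 4 at a hole, and it is even everywhere. In the moving frame a step of
  the dynamics leaves \<open>g k\<close> unchanged, unless \<open>k\<close> is a hole not preceded by two particles, in which
  case \<open>g k\<close> drops by 6. The points of \<open>Q\<close> are the strict left-to-right minima of \<open>g\<close>. A
  drop never reaches the level of a later minimum, so every minimum persists with its level;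
  since the initial minima already occupy every even level exactly once, no new one can appear.
  As \<open>g k\<close> is nonincreasing in time and bounded below by the level of a minimum to the right
  of \<open>k\<close>, it stabilises, and in the limit every hole is preceded by two particles. Between two
  consecutive minima, whose levels differ by 2, this leaves only excursions \<open>011\<close>.\<close>

section \<open>The tilted height and its minima\<close>

definition tilt :: "(int \<Rightarrow> int) \<Rightarrow> int \<Rightarrow> int" where
  "tilt h k = 3 * h k + k"

definition left_minima :: "(int \<Rightarrow> int) \<Rightarrow> int set" where
  "left_minima g = {q. \<forall>i<q. g q < g i}"

text \<open>Because \<open>tilt\<close> takes integer values, the strict inequality with the infimum is a pointwise
  one.\<close>

lemma Q_set_eq: "Q_set h = left_minima (tilt h)"
proof -
  have hs: "hstar h k = of_int (tilt h k) / 3" for k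
    by (simp add: hstar_def tilt_def field_simps)
  have "ereal (hstar h q) < (INF i\<in>{..<q}. ereal (hstar h i)) \<longleftrightarrow> (\<forall>i<q. tilt h q < tilt h i)" for q
  proof
    assume L: "ereal (hstar h q) < (INF i\<in>{..<q}. ereal (hstar h i))"
    show "\<forall>i<q. tilt h q < tilt h i"
    proof (intro allI impI)
      fix i assume "i < q"
      then have "ereal (hstar h q) < ereal (hstar h i)"
        using L less_INF_D by (metis lessThan_iff)
      then show "tilt h q < tilt h i" by (simp add: hs)
    qed
  next
    assume R: "\<forall>i<q. tilt h q < tilt h i"
    have "ereal (hstar h q) < ereal (hstar h q + 1/3)" by simp
    also have "\<dots> \<le> (INF i\<in>{..<q}. ereal (hstar h i))"
    proof (rule INF_greatest)
      fix i assume "i \<in> {..<q}"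
      then have "tilt h q + 1 \<le> tilt h i" using R by force
      then have "real_of_int (tilt h q) + 1 \<le> of_int (tilt h i)" by linarith
      then show "ereal (hstar h q + 1/3) \<le> ereal (hstar h i)" by (simp add: hs)
    qed
    finally show "ereal (hstar h q) < (INF i\<in>{..<q}. ereal (hstar h i))" .
  qed
  then show ?thesis by (simp add: Q_set_def left_minima_def)
qed

section \<open>One step of the dynamics\<close>

text \<open>The normalisation at 0 is omitted because a step need not preserve it.\<close>

definition heights_of :: "config \<Rightarrow> (int \<Rightarrow> int) \<Rightarrow> bool" where
  "heights_of \<eta> h \<longleftrightarrow> (\<forall>k. h k - h (k - 1) = (if \<eta> k then -1 else 1))"

lemma heights_of_init:
  "is_height_profile \<eta> h \<Longrightarrow> heights_of \<eta> h"
  by (auto simp: is_height_profile_def heights_of_def)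

text \<open>Raising \<open>h\<close> by 2 at a jumping particle swaps the descent there with the
  ascent just to its right, matching the exchange of particle and hole.\<close>

lemma heights_of_step:
  assumes "heights_of \<eta> h"
  shows "heights_of (translate (ftasep_step \<eta>)) (\<lambda>k. lifted_height \<eta> h (k - 1) - 1)"
  unfolding heights_of_def
proof
  fix k
  have "h (k - 1) - h (k - 1 - 1) = (if \<eta> (k - 1) then -1 else 1)"
    using assms by (simp only: heights_of_def)
  then show "(lifted_height \<eta> h (k - 1) - 1) - (lifted_height \<eta> h (k - 1 - 1) - 1)
      = (if translate (ftasep_step \<eta>) k then -1 else 1)"
    by (auto simp: lifted_height_def translate_def ftasep_step_def jumps_def split: if_splits)
qed

lemma tilt_step:
  assumes "heights_of \<eta> h"
  shows "tilt h k = tilt h (k - 1) + (if \<eta> k then -2 else 4)"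
proof -
  have "h k - h (k - 1) = (if \<eta> k then -1 else 1)"
    using assms by (simp add: heights_of_def)
  then show ?thesis by (auto simp: tilt_def)
qed

text \<open>At a particle, shifting the profile right and subtracting 1 cancel. At a hole they lower
  \<open>h k\<close> by 2, unless a particle jumps in from \<open>k - 1\<close> and its lift makes
  up for it.\<close>

lemma tilt_evolve:
  assumes "heights_of \<eta> h"
  shows "tilt (\<lambda>k. lifted_height \<eta> h (k - 1) - 1) k =
    tilt h k - (if \<not> \<eta> k \<and> \<not> (\<eta> (k - 1) \<and> \<eta> (k - 2)) then 6 else 0)"
proof -
  have "h k - h (k - 1) = (if \<eta> k then -1 else 1)"
    using assms by (simp add: heights_of_def)
  moreover have "k - 1 - 1 = k - 2" by simp
  ultimately show ?thesis by (auto simp: tilt_def lifted_height_def jumps_def)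
qed

lemma tilt_even_init:
  assumes "is_height_profile \<eta> h"
  shows "even (tilt h k)"
proof (induction k rule: int_induct[where k = 0])
  case base
  then show ?case using assms by (simp add: tilt_def is_height_profile_def)
next
  case (step1 i)
  then show ?case using tilt_step[OF heights_of_init[OF assms], of "i + 1"] by simp
next
  case (step2 i)
  then show ?case using tilt_step[OF heights_of_init[OF assms], of i]
    by (auto split: if_splits)
qed

section \<open>Persistence of minima\<close>

lemma left_minima_unique:
  assumes "q \<in> left_minima g" "q' \<in> left_minima g" "g q = g q'"
  shows "q = q'"
proof (rule linorder_cases)
  show "q < q' \<Longrightarrow> q = q'" "q' < q \<Longrightarrow> q = q'"
    using assms by (force simp: left_minima_def)+
qed

text \<open>A hole at \<open>i\<close> that drops has another hole at \<open>i - 1\<close> or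
  \<open>i - 2\<close>, so it stood at least 6 above \<open>i - 2\<close> or \<open>i - 3\<close>.
  After the drop by 6 it is no lower than that site was before, hence above
  \<open>q\<close>.\<close>

lemma left_minima_persist:
  assumes st: "heights_of \<eta> h" and ev: "\<And>k. even (tilt h k)"
    and q: "q \<in> left_minima (tilt h)"
  defines "g' \<equiv> tilt (\<lambda>k. lifted_height \<eta> h (k - 1) - 1)"
  shows "q \<in> left_minima g'" and "g' q = tilt h q"
proof -
  have less: "tilt h q + 2 \<le> tilt h i" if "i < q" for i
  proof -
    have "tilt h q < tilt h i" using q that by (simp add: left_minima_def)
    then show ?thesis using ev[of q] ev[of i] by presburger
  qed
  \<comment> \<open>An ascent into \<open>q\<close> would make \<open>q - 1\<close> lower, so
    \<open>q\<close> carries a particle and its height does not drop.\<close>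
  have "\<eta> q" using less[of "q - 1"] tilt_step[OF st, of q] by (auto split: if_splits)
  then show eq: "g' q = tilt h q"
    using tilt_evolve[OF st, of q] by (simp add: g'_def)
  have "g' q < g' i" if i: "i < q" for i
  proof -
    have m: "i - 1 - 1 = i - 2" "i - 2 - 1 = i - 3" by simp_all
    show ?thesis
      using less[of i] less[of "i - 1"] less[of "i - 2"] less[of "i - 3"] i eq
        tilt_step[OF st, of i] tilt_step[OF st, of "i - 1"] tilt_step[OF st, of "i - 2"]
        tilt_evolve[OF st, of i]
      unfolding g'_def[symmetric] m by (auto split: if_splits)
  qed
  then show "q \<in> left_minima g'" by (simp add: left_minima_def)
qed

section \<open>Drift and the levels of the initial minima\<close>

lemma int_increments_right:
  fixes g :: "int \<Rightarrow> int"
  assumes "\<And>k. g k = g (k - 1) + (if \<eta> k then -2 else 4)"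
  shows "g (int n) = g 0 + 4 * int n - 6 * (\<Sum>i\<in>{1..int n}. of_bool (\<eta> i))"
proof (induction n)
  case (Suc n)
  have "{1..int (Suc n)} = insert (int (Suc n)) {1..int n}" by auto
  then show ?case using Suc assms[of "int (Suc n)"] by simp
qed simp

text \<open>The increments at the sites of \<open>{- int n..-1}\<close> join
  \<open>- int n - 1\<close> to -1, hence the base point -1 instead of 0.\<close>

lemma int_increments_left:
  fixes g :: "int \<Rightarrow> int"
  assumes "\<And>k. g k = g (k - 1) + (if \<eta> k then -2 else 4)"
  shows "g (- int n - 1) = g (-1) - 4 * int n + 6 * (\<Sum>i\<in>{- int n..-1}. of_bool (\<eta> i))"
proof (induction n)
  case (Suc n)
  define m where "m = - int (Suc n)"
  have m: "- int n - 1 = m" by (simp add: m_def)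
  have "{m..-1} = insert m {- int n..-1}" by (auto simp: m_def)
  then have "(\<Sum>i\<in>{m..-1}. of_bool (\<eta> i)) =
      (of_bool (\<eta> m) :: int) + (\<Sum>i\<in>{- int n..-1}. of_bool (\<eta> i))" by (simp add: m_def)
  moreover have "g m = g (m - 1) + (if \<eta> m then -2 else 4)" by (rule assms)
  moreover have "int (Suc n) = int n + 1" by simp
  ultimately show ?case
    using Suc.IH unfolding m m_def[symmetric] by (cases "\<eta> m") (simp_all del: sum_of_bool_eq)
qed simp

text \<open>The mean increment \<open>4 - 6 * \<rho>\<close> of the tilted height is negative above
  density 2/3.\<close>

lemma drift_unbounded:
  fixes S :: "nat \<Rightarrow> int"
  assumes lim: "(\<lambda>N. of_int (S N) / real N) \<longlonglongrightarrow> \<rho>" and \<rho>: "2 / 3 < \<rho>"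
  shows "\<forall>\<^sub>F N in sequentially. 6 * S N - 4 * int N > C"
proof -
  \<comment> \<open>The midpoint is a density that is eventually exceeded and still gives a positive
    slope \<open>6 * c - 4\<close>.\<close>
  define c where "c = (\<rho> + 2/3) / 2"
  have c: "2/3 < c" "c < \<rho>" using \<rho> by (auto simp: c_def)
  have "filterlim (\<lambda>N. (6 * c - 4) * real N) at_top sequentially"
    using c by (intro filterlim_tendsto_pos_mult_at_top[OF tendsto_const _ filterlim_real_sequentially]) auto
  then have "\<forall>\<^sub>F N in sequentially. (6 * c - 4) * real N > of_int C"
    by (simp add: filterlim_at_top_dense)
  with order_tendstoD(1)[OF lim c(2)] eventually_gt_at_top[of 0]
  show ?thesis
  proof eventually_elim
    case (elim N)
    then have "c * real N < of_int (S N)" by (simp add: field_simps)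
    then have "of_int C < 6 * of_int (S N) - 4 * real N" using elim by (simp add: algebra_simps)
    then have "real_of_int C < of_int (6 * S N - 4 * int N)" by simp
    then show ?case by (simp only: of_int_less_iff)
  qed
qed

text \<open>No level is skipped because the tilted height descends from \<open>\<infinity>\<close> to \<open>-\<infinity>\<close> and can go
  down only by steps of 2.\<close>

lemma left_minima_level:
  assumes hp: "is_height_profile \<eta> h" and X: "\<eta> \<in> X_density \<rho>" and \<rho>: "2 / 3 < \<rho>"
    and M: "even M"
  obtains q where "q \<in> left_minima (tilt h)" "tilt h q = M"
proof -
  let ?g = "tilt h"
  have st: "?g k = ?g (k - 1) + (if \<eta> k then -2 else 4)" for k
    by (rule tilt_step[OF heights_of_init[OF hp]])
  have ev: "even (?g k)" for k by (rule tilt_even_init[OF hp])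
  have limR: "(\<lambda>N. of_int (\<Sum>i\<in>{1..int N}. of_bool (\<eta> i)) / real N) \<longlonglongrightarrow> \<rho>"
    and limL: "(\<lambda>N. of_int (\<Sum>i\<in>{- int N..-1}. of_bool (\<eta> i)) / real N) \<longlonglongrightarrow> \<rho>"
    using X by (simp_all add: X_density_def)
  obtain N where N: "?g (int N) \<le> M"
  proof -
    obtain N where "6 * (\<Sum>i\<in>{1..int N}. of_bool (\<eta> i)) - 4 * int N > ?g 0 - M"
      using drift_unbounded[OF limR \<rho>] eventually_happens'[OF sequentially_bot] by blast
    then have "?g (int N) \<le> M"
      using int_increments_right[of ?g \<eta> N, OF st] by linarith
    then show ?thesis by (rule that)
  qed
  obtain N' where N': "\<And>n. n \<ge> N' \<Longrightarrow> ?g (- int n - 1) > M"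
  proof -
    obtain N' where N': "\<And>n. n \<ge> N' \<Longrightarrow>
        6 * (\<Sum>i\<in>{- int n..-1}. of_bool (\<eta> i)) - 4 * int n > M - ?g (-1)"
      using drift_unbounded[OF limL \<rho>, of "M - ?g (-1)"] unfolding eventually_sequentially by blast
    have "?g (- int n - 1) > M" if "n \<ge> N'" for n
      using N'[OF that] int_increments_left[of ?g \<eta> n, OF st] by linarith
    then show ?thesis by (rule that)
  qed
  define L where "L = - int N' - 1"
  have L: "?g i > M" if "i \<le> L" for i
    using N'[of "nat (- i - 1)"] that by (simp add: L_def)
  \<comment> \<open>All sites up to \<open>L\<close> exceed \<open>M\<close>, so a search starting
    at \<open>L\<close> finds the first site of the whole line with level at most
    \<open>M\<close>.\<close>
  define n where "n = (LEAST n. ?g (L + int n) \<le> M)"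
  define q where "q = L + int n"
  have "?g (L + int (nat (int N - L))) \<le> M" using N L_def by simp
  then have qM: "?g q \<le> M" unfolding q_def n_def by (rule LeastI)
  have before: "?g i > M" if "i < q" for i
  proof (cases "i \<le> L")
    case False
    then have "nat (i - L) < n" using that by (simp add: q_def)
    then have "\<not> ?g (L + int (nat (i - L))) \<le> M" unfolding n_def by (rule not_less_Least)
    then show ?thesis using False by simp
  qed (rule L)
  have "?g (q - 1) > M" by (rule before) simp
  \<comment> \<open>A descent of 2 from above \<open>M\<close> ends above \<open>M - 2\<close>;
    parity then leaves only \<open>M\<close>.\<close>
  then have "?g q > M - 2" using st[of q] by (auto split: if_splits)
  then have "?g q = M" using qM M ev[of q] by presburger
  with before show ?thesis by (intro that[of q]) (auto simp: left_minima_def)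
qed

section \<open>Stabilisation and excursions\<close>

lemma antimono_int_stabilises:
  fixes f :: "nat \<Rightarrow> int"
  assumes dec: "\<And>t. f (Suc t) \<le> f t" and bd: "\<And>t. b \<le> f t"
  shows "\<exists>c. \<forall>\<^sub>F t in sequentially. f t = c"
proof -
  define m where "m = (LEAST m. \<exists>t. nat (f t - b) = m)"
  have "\<exists>t. nat (f t - b) = m" unfolding m_def by (rule LeastI_ex) blast
  then obtain T where T: "nat (f T - b) = m" by blast
  have "f t = f T" if "t \<ge> T" for t
  proof -
    have "f t \<le> f T" using lift_Suc_antimono_le[of f, OF dec] that by blast
    moreover have "m \<le> nat (f t - b)" unfolding m_def by (rule Least_le) blast
    ultimately show ?thesis using T bd[of t] bd[of T] by linarith
  qed
  then show ?thesis unfolding eventually_sequentially by blast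
qed

text \<open>A hole at \<open>p + 1\<close> forces particles at \<open>p + 2\<close> and
  \<open>p + 3\<close>, which bring the height back to its value at \<open>p\<close>, and the
  argument restarts there. A particle at \<open>p + 1\<close> instead reaches the level of
  \<open>q'\<close>, which is first attained at \<open>q'\<close>.\<close>

lemma excursion_string:
  fixes g :: "int \<Rightarrow> int"
  assumes st: "\<And>k. g k = g (k - 1) + (if \<eta> k then -2 else 4)"
    and pre: "\<And>k. \<not> \<eta> k \<Longrightarrow> \<eta> (k - 1) \<and> \<eta> (k - 2)"
    and q': "\<And>i. i < q' \<Longrightarrow> g q' < g i"
    and "p < q'" and "g p = g q' + 2"
  shows "\<exists>n. map \<eta> [p + 1..q'] = concat (replicate n [False, True, True]) @ [True]"
  using assms(4,5)
proof (induction "nat (q' - p)" arbitrary: p rule: less_induct)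
  case less
  show ?case
  proof (cases "\<eta> (p + 1)")
    case True
    then have "g (p + 1) = g q'" using st[of "p + 1"] less.prems by simp
    then have "q' = p + 1" using q'[of "p + 1"] less.prems by force
    then show ?thesis using True by (intro exI[of _ 0]) simp
  next
    case False
    have p2: "\<eta> (p + 2)" and p3: "\<eta> (p + 3)"
      using pre[of "p + 2"] pre[of "p + 3"] False by (auto simp: algebra_simps)
    have g1: "g (p + 1) = g q' + 6" using st[of "p + 1"] False less.prems by simp
    moreover have g2: "g (p + 2) = g (p + 1) - 2" using st[of "p + 2"] p2 by (simp add: algebra_simps)
    moreover have g3: "g (p + 3) = g (p + 2) - 2" using st[of "p + 3"] p3 by (simp add: algebra_simps)
    ultimately have "q' \<noteq> p + 1" "q' \<noteq> p + 2" "q' \<noteq> p + 3" by auto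
    then have lt: "p + 3 < q'" using less.prems by linarith
    then obtain n where n: "map \<eta> [p + 3 + 1..q'] = concat (replicate n [False, True, True]) @ [True]"
      using less.hyps[of "p + 3"] g1 g2 g3 by auto
    have "[p + 1..q'] = [p + 1, p + 2, p + 3] @ [p + 3 + 1..q']"
      using lt by (simp add: upto_rec1)
    then show ?thesis using n False p2 p3 by (intro exI[of _ "Suc n"]) simp
  qed
qed

theorem theorem4p1:
  fixes \<rho> :: real
    and \<eta> :: "nat \<Rightarrow> int \<Rightarrow> bool"
    and h :: "nat \<Rightarrow> int \<Rightarrow> int"
  assumes "2 / 3 < \<rho>" and "\<rho> < 1"
    and "\<eta> 0 \<in> X_density \<rho>"
    and "high_density_evolution \<eta> h"
  shows "\<exists>Q. (\<forall>t. Q_set (h t) = Q) \<and>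
    (\<exists>\<eta>_inf h_inf.
       (\<forall>i. \<forall>\<^sub>F t in sequentially. \<eta> t i = \<eta>_inf i) \<and>
       (\<forall>i. \<forall>\<^sub>F t in sequentially. h t i = h_inf i) \<and>
       (\<forall>q q'. consecutive_in Q q q' \<longrightarrow>
          (\<exists>n::nat. map \<eta>_inf [q + 1..q'] =
             concat (replicate n [False, True, True]) @ [True])))"
proof -
  define g where "g t = tilt (h t)" for t
  define Q where "Q = left_minima (g 0)"
  have init: "is_height_profile (\<eta> 0) (h 0)"
    and \<eta>S: "\<eta> (Suc t) = translate (ftasep_step (\<eta> t))"
    and hS: "h (Suc t) = (\<lambda>k. lifted_height (\<eta> t) (h t) (k - 1) - 1)" for t
    using assms(4) by (auto simp: high_density_evolution_def)
  have ho: "heights_of (\<eta> t) (h t)" for t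
  proof (induction t)
    case 0
    show ?case by (rule heights_of_init[OF init])
  next
    case (Suc t)
    then show ?case unfolding \<eta>S hS by (rule heights_of_step)
  qed
  have st: "g t k = g t (k - 1) + (if \<eta> t k then -2 else 4)" for t k
    unfolding g_def by (rule tilt_step[OF ho])
  have evol: "g (Suc t) k =
      g t k - (if \<not> \<eta> t k \<and> \<not> (\<eta> t (k - 1) \<and> \<eta> t (k - 2)) then 6 else 0)" for t k
    unfolding g_def hS by (rule tilt_evolve[OF ho])
  have ev: "even (g t k)" for t k
  proof (induction t)
    case 0
    show ?case unfolding g_def by (rule tilt_even_init[OF init])
  next
    case (Suc t)
    then show ?case by (simp add: evol)
  qed
  have level: "\<exists>q\<in>Q. g 0 q = M" if "even M" for M
    using left_minima_level[OF init assms(3,1) that] unfolding g_def Q_def by metis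
  have persist: "q \<in> left_minima (g t) \<and> g t q = g 0 q" if "q \<in> Q" for q t
  proof (induction t)
    case 0
    then show ?case using that by (simp add: Q_def)
  next
    case (Suc t)
    then show ?case
      using left_minima_persist[OF ho ev[unfolded g_def], of q t] unfolding g_def hS by simp
  qed
  have minima: "left_minima (g t) = Q" for t
  proof
    show "Q \<subseteq> left_minima (g t)" using persist by blast
    show "left_minima (g t) \<subseteq> Q"
    proof
      fix q assume q: "q \<in> left_minima (g t)"
      \<comment> \<open>The level of \<open>q\<close> already belongs to some persistent
        \<open>r\<close>, and minima at one time have distinct levels.\<close>
      obtain r where r: "r \<in> Q" "g 0 r = g t q" using level[OF ev] by blast
      have "q = r" using left_minima_unique[OF q] persist[OF r(1)] r(2) by metis
      with r(1) show "q \<in> Q" by simp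
    qed
  qed
  have next_Q: "\<exists>q'\<in>Q. q < q' \<and> g 0 q' = g 0 q - 2" if q: "q \<in> Q" for q
  proof -
    obtain q' where q': "q' \<in> Q" "g 0 q' = g 0 q - 2" using level[of "g 0 q - 2"] ev by auto
    have "\<not> q' < q" using q q'(2) by (auto simp: Q_def left_minima_def)
    moreover have "q' \<noteq> q" using q'(2) by auto
    ultimately show ?thesis using q' by force
  qed
  have beyond: "\<exists>q\<in>Q. i < q" for i
  proof -
    obtain q0 where q0: "q0 \<in> Q" using level[of 0] by auto
    have "\<exists>q\<in>Q. q0 + int n \<le> q" for n
    proof (induction n)
      case (Suc n)
      then obtain q q' where "q0 + int n \<le> q" "q' \<in> Q" "q < q'" using next_Q by blast
      then show ?case by (intro bexI[of _ q']) simp_all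
    qed (use q0 in auto)
    then obtain q where "q \<in> Q" "q0 + int (nat (i + 1 - q0)) \<le> q" by blast
    then show ?thesis by (intro bexI[of _ q]) linarith+
  qed
  have "\<exists>c. \<forall>\<^sub>F t in sequentially. g t i = c" for i
  proof -
    obtain q where q: "q \<in> Q" "i < q" using beyond by blast
    \<comment> \<open>A minimum to the right of \<open>i\<close> keeps its level, so it bounds
      \<open>g t i\<close> from below at all times.\<close>
    have "g 0 q \<le> g t i" for t
      using persist[OF q(1), of t] q(2) by (auto simp: left_minima_def intro: less_imp_le)
    then show ?thesis by (intro antimono_int_stabilises[of "\<lambda>t. g t i"]) (simp_all add: evol)
  qed
  then obtain G where G: "\<And>i. \<forall>\<^sub>F t in sequentially. g t i = G i" by metis
  define \<eta>_inf where "\<eta>_inf i \<longleftrightarrow> G i < G (i - 1)" for i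
  define h_inf where "h_inf i = (G i - i) div 3" for i
  have h_lim: "\<forall>\<^sub>F t in sequentially. h t i = h_inf i" for i
    using G[of i] by eventually_elim (auto simp: h_inf_def g_def tilt_def)
  have \<eta>_lim: "\<forall>\<^sub>F t in sequentially. \<eta> t i = \<eta>_inf i" for i
    using G[of i] G[of "i - 1"]
  proof eventually_elim
    case (elim t)
    then show ?case using st[of t i] by (auto simp: \<eta>_inf_def split: if_splits)
  qed
  have stG: "G k = G (k - 1) + (if \<eta>_inf k then -2 else 4)" for k
  proof -
    have "\<forall>\<^sub>F t in sequentially. G k = G (k - 1) + (if \<eta>_inf k then -2 else 4)"
      using G[of k] G[of "k - 1"] \<eta>_lim[of k]
    proof eventually_elim
      case (elim t)
      then show ?case using st[of t k] by simp
    qed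
    then show ?thesis by simp
  qed
  have pre: "\<eta>_inf (k - 1) \<and> \<eta>_inf (k - 2)" if k: "\<not> \<eta>_inf k" for k
  proof -
    \<comment> \<open>Once \<open>g t k\<close> and \<open>g (Suc t) k\<close> both equal
      \<open>G k\<close>, no drop occurs at \<open>k\<close>.\<close>
    have "\<forall>\<^sub>F t in sequentially. g (Suc t) k = G k"
      using G[of k] by (rule eventually_sequentially_Suc[THEN iffD2])
    then have "\<forall>\<^sub>F t in sequentially. \<eta>_inf (k - 1) \<and> \<eta>_inf (k - 2)"
      using G[of k] \<eta>_lim[of k] \<eta>_lim[of "k - 1"] \<eta>_lim[of "k - 2"]
    proof eventually_elim
      case (elim t)
      then show ?case using evol[of t k] k by (auto split: if_splits)
    qed
    then show ?thesis by simp
  qed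
  have GQ: "G q = g 0 q \<and> (\<forall>i<q. G q < G i)" if q: "q \<in> Q" for q
  proof -
    have "\<forall>\<^sub>F t in sequentially. G q = g 0 q"
      using G[of q] by eventually_elim (use persist[OF q] in metis)
    moreover have "\<forall>\<^sub>F t in sequentially. G q < G i" if "i < q" for i
      using G[of q] G[of i]
    proof eventually_elim
      case (elim t)
      then show ?case using persist[OF q, of t] that by (auto simp: left_minima_def)
    qed
    ultimately show ?thesis by simp
  qed
  have "\<exists>n. map \<eta>_inf [q + 1..q'] = concat (replicate n [False, True, True]) @ [True]"
    if c: "consecutive_in Q q q'" for q q'
  proof (rule excursion_string[of G, OF stG pre])
    have q: "q \<in> Q" and q': "q' \<in> Q" and lt: "q < q'"
      and none: "\<And>r. r \<in> Q \<Longrightarrow> q < r \<Longrightarrow> q' \<le> r"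
      using c by (auto simp: consecutive_in_def not_less)
    show "q < q'" by (rule lt)
    show "G q' < G i" if "i < q'" for i using GQ[OF q'] that by blast
    \<comment> \<open>Some later minimum \<open>r\<close> lies exactly 2 below \<open>q\<close>, and
      \<open>q'\<close> comes no later than \<open>r\<close>, so it lies no lower; parity makes the
      gap from \<open>q\<close> to \<open>q'\<close> exactly 2.\<close>
    obtain r where r: "r \<in> Q" "q < r" "g 0 r = g 0 q - 2" using next_Q[OF q] by blast
    have "g 0 q' < g 0 q" using q' lt by (simp add: Q_def left_minima_def)
    moreover have "g 0 r \<le> g 0 q'"
      using r(1) none[OF r(1,2)] by (auto simp: Q_def left_minima_def order_le_less)
    moreover have "even (g 0 q)" "even (g 0 q')" by (rule ev)+
    ultimately have "g 0 q = g 0 q' + 2" using r(3) by presburger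
    then show "G q = G q' + 2" using GQ[OF q] GQ[OF q'] by simp
  qed
  moreover have "Q_set (h t) = Q" for t
    using minima[of t] by (simp add: Q_set_eq g_def)
  ultimately show ?thesis using h_lim \<eta>_lim by blast
qed

end
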